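(* Let $V$ be a function holomorphic in a neighborhood of $0\in\mathbb{C}$ with $V(0)=0$ and $V'(0)\neq 0$, and let $Z$ be its functional inverse near $0$. Put $Y=x\,V'(d/dx)^{-1}$, acting on polynomials in $x$, and $X=y\,Z'(d/dy)^{-1}$, acting on polynomials in $y$. Let $p_n(x)=Y^n1=\sum_k p_{nk}x^k$ and $q_n(y)=X^n1=\sum_k q_{nk}y^k$ be the canonical polynomial sequences of $V$ and of $Z$, respectively. Then for all $n,k\ge 0$: $$\sum_m q_{nm}\,p_m(x)=x^n=q_n(Y)1,\qquad \sum_m q_{nm}\,p_{mk}=\delta_{nk},$$ so that the infinite matrices $(p_{nk})_{n,k\ge0}$ and $(q_{nk})_{n,k\ge0}$ are inverse to each other, and dually $$\sum_m p_{nm}\,q_m(y)=y^n=p_n(X)1.$$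
   Context: For $f$ holomorphic near $0$, $f(d/dx)$ acts on polynomials in $x$ by the power series $\sum_j \frac{f^{(j)}(0)}{j!}(d/dx)^j$ (a finite sum on each polynomial); similarly for $d/dy$ on polynomials in $y$. $V'(d/dx)^{-1}$ is $f(d/dx)$ with $f=1/V'$, and $Z'(d/dy)^{-1}$ is $f(d/dy)$ with $f=1/Z'$. The symbols $x$ and $y$ also denote multiplication operators, and $1$ is the constant polynomial. For a polynomial $f(t)=\sum_m c_m t^m$, $f(Y)1=\sum_m c_m Y^m1$, and similarly for $X$. All sums over indices are finite, since $p_n$ and $q_n$ have degree $n$. *)

theory Defs
  imports
    "HOL-Complex_Analysis.Complex_Analysis"
    "HOL-Computational_Algebra.Polynomial"
begin

text \<open>
  Polynomials in one indeterminate (written \<open>x\<close> or \<open>y\<close>) are elements of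
  \<open>complex poly\<close>, and \<open>pderiv\<close> is the derivation. The sum below is the complete
  series \<open>f(d/dx)\<close>, as \<open>(pderiv ^^ j) p = 0\<close> for \<open>j > degree p\<close>.
\<close>

definition diff_op :: "(complex \<Rightarrow> complex) \<Rightarrow> complex poly \<Rightarrow> complex poly" where
  "diff_op f p = (\<Sum>j\<le>degree p. smult ((deriv ^^ j) f 0 / fact j) ((pderiv ^^ j) p))"

text \<open>The operator \<open>x V'(d/dx)\<inverse>\<close>; \<open>[:0, 1:]\<close> is the indeterminate.\<close>

definition canonical_op :: "(complex \<Rightarrow> complex) \<Rightarrow> complex poly \<Rightarrow> complex poly" where
  "canonical_op V p = [:0, 1:] * diff_op (\<lambda>z. 1 / deriv V z) p"

definition canonical_poly :: "(complex \<Rightarrow> complex) \<Rightarrow> nat \<Rightarrow> complex poly" where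
  "canonical_poly V n = (canonical_op V ^^ n) 1"

definition poly_of_op :: "complex poly \<Rightarrow> (complex poly \<Rightarrow> complex poly) \<Rightarrow> complex poly \<Rightarrow> complex poly" where
  "poly_of_op f T p = (\<Sum>m\<le>degree f. smult (coeff f m) ((T ^^ m) p))"

text \<open>For functions with \<open>V 0 = 0\<close>: \<open>Z\<close> is the inverse of \<open>V\<close> between neighbourhoods of \<open>0\<close>.
  Outside a neighbourhood of \<open>0\<close> the values of \<open>Z\<close> are arbitrary.\<close>

definition inverse_near_0 :: "(complex \<Rightarrow> complex) \<Rightarrow> (complex \<Rightarrow> complex) \<Rightarrow> bool" where
  "inverse_near_0 V Z \<longleftrightarrow>
     (\<exists>U W. open U \<and> open W \<and> 0 \<in> U \<and> 0 \<in> W \<and> bij_betw V U W \<and> (\<forall>z\<in>U. Z (V z) = z))"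

type_synonym inf_matrix = "nat \<Rightarrow> nat \<Rightarrow> complex"

definition row_finite :: "inf_matrix \<Rightarrow> bool" where
  "row_finite A \<longleftrightarrow> (\<forall>n. finite {m. A n m \<noteq> 0})"

text \<open>Only meaningful if the left factor is row-finite.\<close>

definition inf_matrix_mult :: "inf_matrix \<Rightarrow> inf_matrix \<Rightarrow> inf_matrix" where
  "inf_matrix_mult A B n k = (\<Sum>m | A n m \<noteq> 0. A n m * B m k)"

definition inf_matrix_one :: inf_matrix where
  "inf_matrix_one n k = (if n = k then 1 else 0)"

definition inf_matrices_inverse :: "inf_matrix \<Rightarrow> inf_matrix \<Rightarrow> bool" where
  "inf_matrices_inverse A B \<longleftrightarrow> row_finite A \<and> row_finite B \<and>
     inf_matrix_mult A B = inf_matrix_one \<and> inf_matrix_mult B A = inf_matrix_one"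

end

theory Submission
  imports Defs
begin

text \<open>
  Let \<open>\<phi>\<close> be the linear map with \<open>\<phi> (x ^ n) = Y ^ n 1 = p\<^sub>n\<close>, so that \<open>\<phi> x = Y \<phi>\<close> and
  \<open>\<phi> (f) = f(Y) 1\<close>. The commutation relation \<open>V(D) Y - Y V(D) = 1\<close> gives \<open>V(D) \<phi> = \<phi> D\<close>, and
  therefore \<open>(F \<circ> V)(D) \<phi> = \<phi> F(D)\<close> for every power series \<open>F\<close>. For \<open>F = 1 / Z'\<close> one has
  \<open>F \<circ> V = V'\<close>, and so \<open>\<phi> X = \<phi> x F(D) = Y \<phi> F(D) = x V'(D)\<inverse> V'(D) \<phi> = x \<phi>\<close>. Hence
  \<open>\<phi> q\<^sub>n = \<phi> (X ^ n 1) = x ^ n\<close>, and the dual statement follows by exchanging \<open>V\<close> and \<open>Z\<close>.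
\<close>

unbundle no vec_syntax

section \<open>Operators \<open>F(D)\<close> for formal power series \<open>F\<close>, with
  \<open>D\<close> the derivation\<close>

lemma smult_sum_right: "smult c (\<Sum>i\<in>A. f i) = (\<Sum>i\<in>A. smult c (f i))"
  by (induction A rule: infinite_finite_induct) (simp_all add: smult_add_right)

definition fps_diff_op :: "'a::field_char_0 fps \<Rightarrow> 'a poly \<Rightarrow> 'a poly" where
  "fps_diff_op F p = (\<Sum>j\<le>degree p. smult (F $ j) ((pderiv ^^ j) p))"

lemma higher_pderiv_eq_0:
  fixes p :: "'a::field_char_0 poly"
  assumes "degree p < n"
  shows "(pderiv ^^ n) p = 0"
  using assms by (auto simp: poly_eq_iff coeff_higher_pderiv coeff_eq_0)

text \<open>The bound \<open>N\<close> is free so that series applied to different polynomials can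
  be summed over one common range.\<close>

lemma fps_diff_op_eq:
  assumes "degree p \<le> N"
  shows "fps_diff_op F p = (\<Sum>j\<le>N. smult (F $ j) ((pderiv ^^ j) p))"
  unfolding fps_diff_op_def
  by (rule sum.mono_neutral_left) (use assms in \<open>auto simp: higher_pderiv_eq_0\<close>)

lemma fps_diff_op_0 [simp]: "fps_diff_op F 0 = 0"
  by (simp add: fps_diff_op_def)

lemma fps_diff_op_1 [simp]: "fps_diff_op 1 p = p"
  by (simp add: fps_diff_op_def if_distrib[of "\<lambda>c. smult c _"] cong: if_cong)

lemma fps_diff_op_const: "fps_diff_op F [:a:] = [:F $ 0 * a:]"
  by (simp add: fps_diff_op_def)

lemma fps_diff_op_add: "fps_diff_op F (p + q) = fps_diff_op F p + fps_diff_op F q"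
proof -
  let ?N = "max (degree p) (degree q)"
  have "degree (p + q) \<le> ?N" by (simp add: degree_add_le_max)
  then show ?thesis
    by (simp add: fps_diff_op_eq[where N = ?N] higher_pderiv_add smult_add_right sum.distrib)
qed

lemma fps_diff_op_smult: "fps_diff_op F (smult c p) = smult c (fps_diff_op F p)"
  by (simp add: fps_diff_op_eq[where N = "degree p"] degree_smult_le higher_pderiv_smult
      smult_sum_right mult.commute)

lemma fps_diff_op_sum: "fps_diff_op F (\<Sum>i\<in>A. f i) = (\<Sum>i\<in>A. fps_diff_op F (f i))"
  by (induction A rule: infinite_finite_induct) (simp_all add: fps_diff_op_add)

text \<open>Powers of \<open>D\<close> add under composition, so grouping the double sum by total
  order yields the Cauchy product of the coefficients.\<close>

lemma fps_diff_op_mult: "fps_diff_op (F * G) p = fps_diff_op F (fps_diff_op G p)"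
proof -
  let ?N = "degree p" and ?D = "\<lambda>j. (pderiv ^^ j) p"
  have "fps_diff_op F (fps_diff_op G p)
      = (\<Sum>j\<le>?N. smult (G $ j) (fps_diff_op F (?D j)))"
    by (simp add: fps_diff_op_def[of G] fps_diff_op_sum fps_diff_op_smult)
  also have "\<dots> = (\<Sum>j\<le>?N. \<Sum>i\<le>?N. smult (F $ i * G $ j) (?D (i + j)))"
    by (simp add: fps_diff_op_eq[where N = ?N] degree_higher_pderiv smult_sum_right funpow_add
        mult.commute)
  also have "\<dots> = (\<Sum>(i,j)\<in>{..?N} \<times> {..?N}. smult (F $ i * G $ j) (?D (i + j)))"
    by (subst sum.swap) (simp add: sum.cartesian_product)
  \<comment> \<open>Derivatives of order above the degree vanish, which cuts the square of index
    pairs down to a triangle.\<close>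
  also have "\<dots> = (\<Sum>(i,j)\<in>{(i,j). i + j \<le> ?N}. smult (F $ i * G $ j) (?D (i + j)))"
    by (rule sum.mono_neutral_right) (auto, metis higher_pderiv_eq_0 not_le)
  also have "\<dots> = (\<Sum>k\<le>?N. \<Sum>i\<le>k. smult (F $ i * G $ (k - i)) (?D k))"
    by (subst sum.triangle_reindex_eq) simp
  also have "\<dots> = fps_diff_op (F * G) p"
    by (simp add: fps_diff_op_def fps_mult_nth smult_sum atLeast0AtMost)
  finally show ?thesis by simp
qed

text \<open>Leibniz rule for \<open>x p\<close>, where only the first two terms survive. For
  \<open>n = 0\<close> the truncated \<open>n - 1\<close> is harmless because its factor is
  zero.\<close>

lemma higher_pderiv_pCons_0:
  "(pderiv ^^ n) (pCons 0 p) = pCons 0 ((pderiv ^^ n) p) + smult (of_nat n) ((pderiv ^^ (n - 1)) p)"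
proof (induction n)
  case (Suc n)
  then show ?case
    by (cases n) (simp_all add: pderiv_add pderiv_pCons pderiv_smult smult_add_left ac_simps)
qed simp

text \<open>The commutator of \<open>F(D)\<close> with multiplication by \<open>x\<close> is
  \<open>F'(D)\<close>, by the Leibniz rule applied term by term.\<close>

lemma fps_diff_op_pCons_0:
  "fps_diff_op F (pCons 0 p) = pCons 0 (fps_diff_op F p) + fps_diff_op (fps_deriv F) p"
proof -
  let ?N = "degree p"
  have "fps_diff_op F (pCons 0 p)
      = (\<Sum>j\<le>Suc ?N. smult (F $ j) (pCons 0 ((pderiv ^^ j) p)))
      + (\<Sum>j\<le>Suc ?N. smult (F $ j * of_nat j) ((pderiv ^^ (j - 1)) p))"
    by (simp add: fps_diff_op_eq[where N = "Suc ?N"] degree_pCons_le higher_pderiv_pCons_0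
        smult_add_right sum.distrib del: sum.atMost_Suc)
  also have "(\<Sum>j\<le>Suc ?N. smult (F $ j) (pCons 0 ((pderiv ^^ j) p)))
      = [:0, 1:] * (\<Sum>j\<le>Suc ?N. smult (F $ j) ((pderiv ^^ j) p))"
    unfolding sum_distrib_left by simp
  also have "(\<Sum>j\<le>Suc ?N. smult (F $ j) ((pderiv ^^ j) p)) = fps_diff_op F p"
    by (rule fps_diff_op_eq[symmetric]) simp
  \<comment> \<open>The term \<open>j = 0\<close> vanishes, and shifting the index turns
    \<open>j F_j\<close> into the coefficients of \<open>F'\<close>.\<close>
  also have "(\<Sum>j\<le>Suc ?N. smult (F $ j * of_nat j) ((pderiv ^^ (j - 1)) p))
      = fps_diff_op (fps_deriv F) p"
    by (simp add: sum.atMost_Suc_shift fps_diff_op_def mult.commute del: sum.atMost_Suc)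
  finally show ?thesis by simp
qed

text \<open>This expresses \<open>(F oo V)(D)\<close> as \<open>F\<close> evaluated at
  \<open>V(D)\<close>. As \<open>V\<close> has no constant term, \<open>V(D)\<close> lowers degrees,
  so the series in \<open>i\<close> may stop at \<open>N\<close>.\<close>

lemma fps_diff_op_compose:
  assumes "V $ 0 = 0" and "degree p \<le> N"
  shows "fps_diff_op (F oo V) p = (\<Sum>i\<le>N. smult (F $ i) (fps_diff_op (V ^ i) p))"
proof -
  have "fps_diff_op (F oo V) p
      = (\<Sum>n\<le>N. \<Sum>i\<le>n. smult (F $ i * (V ^ i) $ n) ((pderiv ^^ n) p))"
    by (simp add: fps_diff_op_eq[OF assms(2)] fps_compose_nth smult_sum atLeast0AtMost)
  \<comment> \<open>The added terms have \<open>i > n\<close>, and \<open>V ^ i\<close> has no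
    coefficient of order below \<open>i\<close>.\<close>
  also have "\<dots> = (\<Sum>n\<le>N. \<Sum>i\<le>N. smult (F $ i * (V ^ i) $ n) ((pderiv ^^ n) p))"
    using startsby_zero_power_prefix[OF assms(1)]
    by (intro sum.cong refl sum.mono_neutral_left) auto
  also have "\<dots> = (\<Sum>i\<le>N. smult (F $ i) (fps_diff_op (V ^ i) p))"
    by (subst sum.swap) (simp add: fps_diff_op_eq[OF assms(2)] smult_sum_right)
  finally show ?thesis .
qed

section \<open>Evaluation of polynomials at an operator\<close>

lemma poly_of_op_eq:
  assumes "degree f \<le> N"
  shows "poly_of_op f T p = (\<Sum>m\<le>N. smult (coeff f m) ((T ^^ m) p))"
  unfolding poly_of_op_def
  by (rule sum.mono_neutral_left) (use assms in \<open>auto simp: coeff_eq_0\<close>)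

lemma poly_of_op_0 [simp]: "poly_of_op 0 T p = 0"
  by (simp add: poly_of_op_def)

lemma poly_of_op_add: "poly_of_op (f + g) T p = poly_of_op f T p + poly_of_op g T p"
proof -
  let ?N = "max (degree f) (degree g)"
  have "degree (f + g) \<le> ?N" by (simp add: degree_add_le_max)
  then show ?thesis
    by (simp add: poly_of_op_eq[where N = ?N] smult_add_left sum.distrib)
qed

lemma poly_of_op_smult: "poly_of_op (smult c f) T p = smult c (poly_of_op f T p)"
  by (simp add: poly_of_op_eq[where N = "degree f"] degree_smult_le smult_sum_right)

lemma poly_of_op_sum: "poly_of_op (\<Sum>i\<in>A. f i) T p = (\<Sum>i\<in>A. poly_of_op (f i) T p)"
  by (induction A rule: infinite_finite_induct) (simp_all add: poly_of_op_add)

text \<open>Horner's scheme for a linear \<open>T\<close>. It makes induction over the polynomial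
  \<open>f\<close> available.\<close>

lemma poly_of_op_pCons:
  assumes add: "\<And>p q. T (p + q) = T p + T q" and smult: "\<And>c p. T (smult c p) = smult c (T p)"
  shows "poly_of_op (pCons a f) T p = smult a p + T (poly_of_op f T p)"
proof -
  have T0: "T 0 = 0" using smult[of 0 0] by simp
  have T_sum: "T (\<Sum>i\<in>A. g i) = (\<Sum>i\<in>A. T (g i))" for g :: "nat \<Rightarrow> complex poly" and A
    by (induction A rule: infinite_finite_induct) (simp_all add: add T0)
  show ?thesis
    by (simp add: poly_of_op_eq[where N = "Suc (degree f)"] degree_pCons_le poly_of_op_def[of f]
        sum.atMost_Suc_shift T_sum smult del: sum.atMost_Suc)
qed

section \<open>Canonical operators of formal power series\<close>

definition fps_canonical_op :: "complex fps \<Rightarrow> complex poly \<Rightarrow> complex poly" where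
  "fps_canonical_op V p = pCons 0 (fps_diff_op (inverse (fps_deriv V)) p)"

lemma fps_canonical_op_add:
  "fps_canonical_op V (p + q) = fps_canonical_op V p + fps_canonical_op V q"
  by (simp add: fps_canonical_op_def fps_diff_op_add)

lemma fps_canonical_op_smult:
  "fps_canonical_op V (smult c p) = smult c (fps_canonical_op V p)"
  by (simp add: fps_canonical_op_def fps_diff_op_smult)

lemma poly_of_canonical_op_pCons:
  "poly_of_op (pCons a f) (fps_canonical_op V) p
     = smult a p + fps_canonical_op V (poly_of_op f (fps_canonical_op V) p)"
  by (rule poly_of_op_pCons) (simp_all add: fps_canonical_op_add fps_canonical_op_smult)

text \<open>Moving \<open>V(D)\<close> past \<open>x\<close> leaves the extra term
  \<open>V'(D)\<close>, which cancels against the factor \<open>V'(D)\<^sup>-\<^sup>1\<close> of the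
  canonical operator.\<close>

lemma fps_diff_op_canonical_commutator:
  assumes "fps_deriv V $ 0 \<noteq> 0"
  shows "fps_diff_op V (fps_canonical_op V p) = fps_canonical_op V (fps_diff_op V p) + p"
proof -
  let ?G = "inverse (fps_deriv V)"
  have "fps_diff_op V (fps_diff_op ?G p) = fps_diff_op ?G (fps_diff_op V p)"
    by (simp add: mult.commute flip: fps_diff_op_mult)
  moreover have "fps_diff_op (fps_deriv V) (fps_diff_op ?G p) = p"
    using inverse_mult_eq_1'[OF assms] by (simp flip: fps_diff_op_mult)
  ultimately show ?thesis
    by (simp add: fps_canonical_op_def fps_diff_op_pCons_0)
qed

text \<open>This is \<open>V(D) \<phi> = \<phi> D\<close>. Constants are killed by
  \<open>V(D)\<close> as \<open>V $ 0 = 0\<close>; for \<open>x p\<close>, the commutator supplies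
  the extra summand of the product rule.\<close>

lemma fps_diff_op_poly_of_canonical_op:
  assumes "V $ 0 = 0" and "fps_deriv V $ 0 \<noteq> 0"
  shows "fps_diff_op V (poly_of_op p (fps_canonical_op V) 1)
      = poly_of_op (pderiv p) (fps_canonical_op V) 1"
proof (induction p)
  case (pCons a p)
  have "fps_diff_op V (smult a 1) = 0"
    using assms(1) by (simp add: one_pCons fps_diff_op_const)
  with pCons.IH show ?case
    by (simp add: poly_of_canonical_op_pCons fps_diff_op_add fps_diff_op_canonical_commutator[OF assms(2)]
        pderiv_pCons poly_of_op_add poly_of_canonical_op_pCons add.commute)
qed simp

lemma fps_diff_op_compose_poly_of_canonical_op:
  assumes "V $ 0 = 0" and "fps_deriv V $ 0 \<noteq> 0"
  shows "fps_diff_op (F oo V) (poly_of_op p (fps_canonical_op V) 1)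
      = poly_of_op (fps_diff_op F p) (fps_canonical_op V) 1"
proof -
  let ?\<phi> = "\<lambda>p. poly_of_op p (fps_canonical_op V) 1"
  have pow: "fps_diff_op (V ^ i) (?\<phi> p) = ?\<phi> ((pderiv ^^ i) p)" for i
    by (induction i) (simp_all add: fps_diff_op_mult fps_diff_op_poly_of_canonical_op[OF assms])
  \<comment> \<open>One bound has to serve both truncated series: the one on \<open>p\<close> and
    the one on its image under \<open>\<phi>\<close>.\<close>
  let ?N = "max (degree p) (degree (?\<phi> p))"
  show ?thesis
    by (simp add: fps_diff_op_compose[OF assms(1), where N = ?N] pow
        fps_diff_op_eq[where N = ?N and p = p] poly_of_op_sum poly_of_op_smult)
qed

text \<open>The map \<open>\<phi>\<close> built from \<open>V\<close> carries the canonical operator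
  of \<open>Z\<close> to multiplication by \<open>x\<close>.\<close>

lemma poly_of_canonical_op_intertwines:
  assumes V: "V $ 0 = 0" "fps_deriv V $ 0 \<noteq> 0" and Z: "fps_deriv Z $ 0 \<noteq> 0"
    and inv: "Z oo V = fps_X"
  shows "poly_of_op (fps_canonical_op Z p) (fps_canonical_op V) 1
      = pCons 0 (poly_of_op p (fps_canonical_op V) 1)"
proof -
  let ?\<phi> = "\<lambda>p. poly_of_op p (fps_canonical_op V) 1"
  \<comment> \<open>Chain rule applied to \<open>Z oo V = fps_X\<close>.\<close>
  have "(fps_deriv Z oo V) * fps_deriv V = 1"
    using fps_compose_deriv[OF V(1), of Z] by (simp add: inv)
  then have comp: "inverse (fps_deriv Z) oo V = fps_deriv V"
    by (simp add: fps_inverse_compose[OF V(1) Z] fps_inverse_unique)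
  have "?\<phi> (fps_canonical_op Z p)
      = fps_canonical_op V (fps_diff_op (inverse (fps_deriv Z) oo V) (?\<phi> p))"
    by (simp add: fps_canonical_op_def[of Z] poly_of_canonical_op_pCons
        fps_diff_op_compose_poly_of_canonical_op[OF V])
  also have "\<dots> = pCons 0 (?\<phi> p)"
    using inverse_mult_eq_1[OF V(2)]
    by (simp add: comp fps_canonical_op_def flip: fps_diff_op_mult)
  finally show ?thesis .
qed

lemma poly_of_canonical_op_canonical:
  assumes "V $ 0 = 0" "fps_deriv V $ 0 \<noteq> 0" "fps_deriv Z $ 0 \<noteq> 0" "Z oo V = fps_X"
  shows "poly_of_op ((fps_canonical_op Z ^^ n) 1) (fps_canonical_op V) 1 = monom 1 n"
proof (induction n)
  case 0
  then show ?case by (simp add: poly_of_op_def)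
next
  case (Suc n)
  then show ?case
    by (simp add: poly_of_canonical_op_intertwines[OF assms] monom_Suc)
qed

section \<open>From holomorphic functions to their Taylor series\<close>

lemma canonical_op_eq_fps:
  assumes "V has_fps_expansion F" and "fps_deriv F $ 0 \<noteq> 0"
  shows "canonical_op V = fps_canonical_op F"
proof
  fix p
  have "(\<lambda>z. inverse (deriv V z)) has_fps_expansion inverse (fps_deriv F)"
    by (intro has_fps_expansion_inverse has_fps_expansion_deriv assms)
  then have "(\<lambda>z. 1 / deriv V z) has_fps_expansion inverse (fps_deriv F)"
    by (simp add: inverse_eq_divide)
  then show "canonical_op V p = fps_canonical_op F p"
    by (simp add: canonical_op_def fps_canonical_op_def diff_op_def fps_diff_op_def
        fps_nth_fps_expansion)
qed

text \<open>Holomorphy of \<open>Z\<close> near 0 is derived rather than given: after shrinking to a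
  neighbourhood where \<open>V\<close> is holomorphic and injective, \<open>Z\<close> coincides with
  the holomorphic inverse on the open image.\<close>

lemma inverse_near_0_fps_expansions:
  assumes S: "open S" "0 \<in> S" and hol: "V holomorphic_on S" and V0: "V 0 = 0"
    and inv: "inverse_near_0 V Z"
  obtains F G where "V has_fps_expansion F" "Z has_fps_expansion G"
    "F $ 0 = 0" "G $ 0 = 0" "fps_deriv F $ 0 \<noteq> 0" "fps_deriv G $ 0 \<noteq> 0"
    "G oo F = fps_X" "F oo G = fps_X"
proof -
  obtain U W where U: "open U" "0 \<in> U" "bij_betw V U W" "\<And>z. z \<in> U \<Longrightarrow> Z (V z) = z"
    using inv unfolding inverse_near_0_def by blast
  define C where "C = U \<inter> S"
  have C: "open C" "0 \<in> C" and hol: "V holomorphic_on C" and inj: "inj_on V C"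
    and ZV: "\<And>z. z \<in> C \<Longrightarrow> Z (V z) = z"
    using S U hol unfolding C_def
    by (auto intro: holomorphic_on_subset inj_on_subset simp: bij_betw_def)
  have opn: "open (V ` C)"
    using hol C(1) inj by (rule open_mapping_thm3)
  have mem: "0 \<in> V ` C"
    using C(2) V0 by force
  have Z0: "Z 0 = 0"
    using ZV[OF C(2)] V0 by simp
  obtain g where g: "g holomorphic_on V ` C" "\<And>z. z \<in> C \<Longrightarrow> g (V z) = z"
    using holomorphic_has_inverse[OF hol C(1) inj] by metis
  have "Z holomorphic_on V ` C"
    using g(1) by (rule holomorphic_transform) (auto simp: ZV g(2))
  then obtain G where G: "Z has_fps_expansion G"
    using has_fps_expansion_fps_expansion[OF opn mem] by blast
  obtain F where F: "V has_fps_expansion F"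
    using has_fps_expansion_fps_expansion[OF C hol] by blast
  have F0: "F $ 0 = 0" and G0: "G $ 0 = 0"
    using F G by (simp_all add: fps_nth_fps_expansion V0 Z0)
  have "eventually (\<lambda>z. (Z \<circ> V) z = z) (nhds 0)"
    using C ZV by (auto simp: eventually_nhds)
  moreover have "(Z \<circ> V) has_fps_expansion (G oo F)"
    using G F F0 by (rule has_fps_expansion_compose)
  ultimately have "(\<lambda>z. z) has_fps_expansion (G oo F)"
    by (rule has_fps_expansion_cong[OF _ refl, THEN iffD1])
  then have GF: "G oo F = fps_X"
    using has_fps_expansion_fps_X fps_expansion_unique_complex by blast
  have "eventually (\<lambda>z. (V \<circ> Z) z = z) (nhds 0)"
    using opn mem ZV by (force simp: eventually_nhds)
  moreover have "(V \<circ> Z) has_fps_expansion (F oo G)"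
    using F G G0 by (rule has_fps_expansion_compose)
  ultimately have "(\<lambda>z. z) has_fps_expansion (F oo G)"
    by (rule has_fps_expansion_cong[OF _ refl, THEN iffD1])
  then have FG: "F oo G = fps_X"
    using has_fps_expansion_fps_X fps_expansion_unique_complex by blast
  \<comment> \<open>By the chain rule the constant coefficients of the two derivatives have product
    1, so neither is zero.\<close>
  have "((fps_deriv G oo F) * fps_deriv F) $ 0 = 1"
    using fps_compose_deriv[OF F0, of G] by (simp add: GF)
  then have "fps_deriv F $ 0 \<noteq> 0" "fps_deriv G $ 0 \<noteq> 0"
    by (auto simp: fps_mult_nth)
  with that F G F0 G0 GF FG show ?thesis by blast
qed

section \<open>Coefficient matrices and the final assembly\<close>

lemma inf_matrix_mult_coeff:
  "inf_matrix_mult (\<lambda>n k. coeff (p n) k) B n k = (\<Sum>m\<le>degree (p n). coeff (p n) m * B m k)"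
  unfolding inf_matrix_mult_def
  by (rule sum.mono_neutral_left) (auto simp: le_degree)

lemma row_finite_coeff: "row_finite (\<lambda>n k. coeff (p n) k)"
  unfolding row_finite_def
  using MOST_coeff_eq_0[where 'a = complex] by (simp add: eventually_cofinite)

theorem mainTheorem2:
  fixes V Z :: "complex \<Rightarrow> complex" and S :: "complex set"
  assumes "open S" and "0 \<in> S" and "V holomorphic_on S"
    and "V 0 = 0" and "deriv V 0 \<noteq> 0"
    and "inverse_near_0 V Z"
  shows
    "(\<forall>n. (\<Sum>m\<le>degree (canonical_poly Z n).
              smult (coeff (canonical_poly Z n) m) (canonical_poly V m)) = monom 1 n
          \<and> monom 1 n = poly_of_op (canonical_poly Z n) (canonical_op V) 1)
     \<and> (\<forall>n k. (\<Sum>m\<le>degree (canonical_poly Z n).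
              coeff (canonical_poly Z n) m * coeff (canonical_poly V m) k) = (if n = k then 1 else 0))
     \<and> inf_matrices_inverse (\<lambda>n k. coeff (canonical_poly V n) k) (\<lambda>n k. coeff (canonical_poly Z n) k)
     \<and> (\<forall>n. (\<Sum>m\<le>degree (canonical_poly V n).
              smult (coeff (canonical_poly V n) m) (canonical_poly Z m)) = monom 1 n
          \<and> monom 1 n = poly_of_op (canonical_poly V n) (canonical_op Z) 1)"
proof -
  obtain F G where exp: "V has_fps_expansion F" "Z has_fps_expansion G"
    and F: "F $ 0 = 0" "fps_deriv F $ 0 \<noteq> 0" and G: "G $ 0 = 0" "fps_deriv G $ 0 \<noteq> 0"
    and inv: "G oo F = fps_X" "F oo G = fps_X"
    using inverse_near_0_fps_expansions[OF assms(1-4,6)] by metis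
  note ops = canonical_op_eq_fps[OF exp(1) F(2)] canonical_op_eq_fps[OF exp(2) G(2)]
  have VZ: "poly_of_op (canonical_poly Z n) (canonical_op V) 1 = monom 1 n" for n
    using poly_of_canonical_op_canonical[OF F G(2) inv(1)] by (simp add: canonical_poly_def ops)
  have ZV: "poly_of_op (canonical_poly V n) (canonical_op Z) 1 = monom 1 n" for n
    using poly_of_canonical_op_canonical[OF G F(2) inv(2)] by (simp add: canonical_poly_def ops)
  have poly_of_op: "poly_of_op p (canonical_op A) 1
      = (\<Sum>m\<le>degree p. smult (coeff p m) (canonical_poly A m))" for p A
    by (simp add: poly_of_op_def canonical_poly_def)
  \<comment> \<open>The matrix identities are the polynomial identities read off at the coefficient
    of \<open>x ^ k\<close>.\<close>
  have coeffs: "(\<Sum>m\<le>degree p. coeff p m * coeff (canonical_poly A m) k) = (if n = k then 1 else 0)"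
    if "poly_of_op p (canonical_op A) 1 = monom 1 n" for p A n k
    using arg_cong[OF that, of "\<lambda>q. coeff q k"] by (simp add: poly_of_op coeff_sum)
  have "inf_matrices_inverse (\<lambda>n k. coeff (canonical_poly V n) k)
      (\<lambda>n k. coeff (canonical_poly Z n) k)"
    unfolding inf_matrices_inverse_def
    by (auto simp: row_finite_coeff inf_matrix_mult_coeff inf_matrix_one_def coeffs VZ ZV fun_eq_iff)
  with VZ ZV coeffs[OF VZ] show ?thesis
    by (simp add: poly_of_op)
qed

end
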